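(* Let $E\subset\mathbb{R}$ be a nonempty set and let $\alpha>0$. Then $d_E^{\,-\alpha}\in A_1^+$ if and only if $\alpha<\mathrm{Mu}_1^+(E)$.
   Context: Lebesgue measure on $\mathbb{R}$ is denoted $|\cdot|$. Throughout, $I=(a,b)$ with $a<b$ real denotes a bounded open interval; $I^-=(a,\frac{a+b}{2})$ and $I^+=(\frac{a+b}{2},b)$. $d_E(x)=\inf\{|x-y|:y\in E\}$; $d_E^{\,-\alpha}(x)=d_E(x)^{-\alpha}$, equal to $+\infty$ where $d_E(x)=0$. For $r>0$, $E_r=\{x\in\mathbb{R}:d_E(x)<r\}$. A weight on $\mathbb{R}$ is a locally integrable function $w:\mathbb{R}\to[0,\infty]$ with $w>0$ a.e. A weight $w$ belongs to $A_1^+$ if $$\sup_{I\subset\mathbb{R}}\Big(\frac{1}{|I^-|}\int_{I^-}w\Big)\operatorname*{ess\,sup}_{I^+}(w^{-1})<\infty.$$ The statement $d_E^{\,-\alpha}\in A_1^+$ includes the assertion that $d_E^{\,-\alpha}$ is a weight. For $0<s\le1$, $L_s(E,I)$ is the supremum of all $\ell>0$ for which there exist an integer $k\ge1$ and disjoint open intervals $I_1,\dots,I_k\subset I\setminus E$ with $|I_i|\ge\ell$ for all $i$ and $\sum_{i=1}^k|I_i|\ge(1-s)|I|$; if no such $\ell$ exists, $L_s(E,I)=0$. In particular $L_1(E,I)$ is the supremum of the lengths of open intervals contained in $I\setminus E$ (or $0$ if there are none). One-sided $1$-Muckenhoupt exponent: if $L_1(E,I)=0$ for some bounded open interval $I$,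 set $\mathrm{Mu}_1^+(E)=0$. Otherwise $\mathrm{Mu}_1^+(E)$ is the supremum of all $\alpha\ge0$ for which there exists $C>0$ such that, for every bounded open interval $I$ centred at a point of $E$ and every $0<r\le L_1(E,I^+)$, $$\frac{|I^-\cap E_r|}{|I^-|}\le C\Big(\frac{r}{L_1(E,I^+)}\Big)^\alpha.$$ *)

theory Defs
  imports "HOL-Analysis.Analysis" "HOL-Probability.Essential_Supremum"
begin

text \<open>A bounded open interval \<open>I = {a<..<b}\<close> is given by its endpoints \<open>a < b\<close>.\<close>

definition left_half :: "real \<Rightarrow> real \<Rightarrow> real set" where
  "left_half a b = {a<..<(a + b) / 2}"

definition right_half :: "real \<Rightarrow> real \<Rightarrow> real set" where
  "right_half a b = {(a + b) / 2<..<b}"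

text \<open>For nonempty \<open>E\<close>, \<open>infdist x E\<close> is the infimum of \<open>\<bar>x - y\<bar>\<close> over \<open>y \<in> E\<close>.
  The case distinction is needed since \<open>0 powr (- \<alpha>) = 0\<close>.\<close>

definition dist_weight :: "real set \<Rightarrow> real \<Rightarrow> real \<Rightarrow> ennreal" where
  "dist_weight E \<alpha> x =
     (if infdist x E = 0 then \<infinity> else ennreal (infdist x E powr (- \<alpha>)))"

definition nbhd :: "real set \<Rightarrow> real \<Rightarrow> real set" where
  "nbhd E r = {x. infdist x E < r}"

definition locally_integrable :: "(real \<Rightarrow> ennreal) \<Rightarrow> bool" where
  "locally_integrable w \<longleftrightarrow>
     w \<in> borel_measurable lebesgue \<and>
     (\<forall>K. compact K \<longrightarrow> (\<integral>\<^sup>+x\<in>K. w x \<partial>lebesgue) < \<infinity>)"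

definition weight :: "(real \<Rightarrow> ennreal) \<Rightarrow> bool" where
  "weight w \<longleftrightarrow> locally_integrable w \<and> (AE x in lebesgue. w x > 0)"

text \<open>On \<open>ennreal\<close>, \<open>inverse 0 = \<infinity>\<close>, \<open>inverse \<infinity> = 0\<close> and \<open>0 * \<infinity> = 0\<close>; for a weight
  the averages below are positive and finite, so the last convention plays no role.\<close>

definition A1_plus :: "(real \<Rightarrow> ennreal) \<Rightarrow> bool" where
  "A1_plus w \<longleftrightarrow> weight w \<and>
     Sup {((\<integral>\<^sup>+x\<in>left_half a b. w x \<partial>lebesgue) / emeasure lebesgue (left_half a b))
            * esssup (restrict_space lebesgue (right_half a b)) (\<lambda>x. inverse (w x))
          | a b. a < b} < \<infinity>"

text \<open>The lengths \<open>l\<close> competing in the supremum that defines \<open>L\<^sub>s(E,(a,b))\<close>; the i-th interval is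
  \<open>{c i<..<d i}\<close>. Since \<open>k \<ge> 1\<close>, the set is bounded above by \<open>b - a\<close>, so its real \<open>Sup\<close> is
  meaningful whenever it is nonempty.\<close>

definition gap_lengths :: "real \<Rightarrow> real set \<Rightarrow> real \<Rightarrow> real \<Rightarrow> real set" where
  "gap_lengths s E a b =
     {l. l > 0 \<and>
        (\<exists>(k::nat) (c :: nat \<Rightarrow> real) (d :: nat \<Rightarrow> real). k \<ge> 1 \<and>
           (\<forall>i<k. c i < d i \<and> {c i<..<d i} \<subseteq> {a<..<b} - E \<and> d i - c i \<ge> l) \<and>
           disjoint_family_on (\<lambda>i. {c i<..<d i}) {..<k} \<and>
           (\<Sum>i<k. d i - c i) \<ge> (1 - s) * (b - a))}"

definition gap_L :: "real \<Rightarrow> real set \<Rightarrow> real \<Rightarrow> real \<Rightarrow> real" where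
  "gap_L s E a b =
     (if gap_lengths s E a b = {} then 0 else Sup (gap_lengths s E a b))"

text \<open>Admissible exponents of the one-sided 1-Muckenhoupt condition; \<open>{a<..<b}\<close> is centred at
  a point of \<open>E\<close>, and \<open>gap_L 1 E ((a + b) / 2) b\<close> is \<open>L\<^sub>1\<close> of its right half.\<close>

definition Mu1_plus_exponents :: "real set \<Rightarrow> real set" where
  "Mu1_plus_exponents E =
     {\<alpha>. \<alpha> \<ge> 0 \<and>
        (\<exists>C>0. \<forall>a b r. a < b \<longrightarrow> (a + b) / 2 \<in> E \<longrightarrow>
           0 < r \<longrightarrow> r \<le> gap_L 1 E ((a + b) / 2) b \<longrightarrow>
           measure lebesgue (left_half a b \<inter> nbhd E r) / measure lebesgue (left_half a b)
             \<le> C * (r / gap_L 1 E ((a + b) / 2) b) powr \<alpha>)}"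

definition Mu1_plus :: "real set \<Rightarrow> ereal" where
  "Mu1_plus E =
     (if \<exists>a b. a < b \<and> gap_L 1 E a b = 0 then 0
      else Sup (ereal ` Mu1_plus_exponents E))"

end

theory Submission
  imports Defs
begin

text \<open>
  Write \<open>d\<close> for the distance to \<open>E\<close>, \<open>w = d\<^sup>-\<^sup>\<alpha>\<close>, and \<open>I\<^sup>-\<close>, \<open>I\<^sup>+\<close> for the two halves of an interval
  \<open>I\<close>. As \<open>d\<close> is continuous, the essential supremum of \<open>1/w\<close> over \<open>I\<^sup>+\<close> is the supremum of \<open>d\<^sup>\<alpha>\<close>, so
  the condition \<open>A\<^sub>1\<^sup>+\<close> says that the average of \<open>w\<close> over \<open>I\<^sup>-\<close> is at most a constant times \<open>d(x)\<^sup>-\<^sup>\<alpha>\<close>, for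
  every \<open>x \<in> I\<^sup>+\<close>. When \<open>I\<close> is centred at a point of \<open>E\<close>, the length \<open>L\<close> of the largest gap in \<open>I\<^sup>+\<close> is
  comparable to the supremum of \<open>d\<close> over \<open>I\<^sup>+\<close>: the midpoint of a gap of length \<open>l\<close> has \<open>d \<ge> l/2\<close>, and
  left of a point \<open>x \<in> I\<^sup>+\<close> there is a gap of length \<open>d(x)\<close> that does not reach beyond the centre. So
  both conditions compare \<open>I\<^sup>-\<close> with the points of \<open>I\<^sup>+\<close> that are far from \<open>E\<close>.

  If \<open>w \<in> A\<^sub>1\<^sup>+\<close>, Chebyshev's inequality gives that \<open>\<alpha>\<close> itself is an admissible exponent. A strictly
  larger one comes from self-improvement, in the manner of Gehring's lemma. Fix \<open>p < q\<close> and consider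
  \<open>S\<^sub>s = {x \<in> (p,q). d(x) < s}\<close> for \<open>s \<le> d(q)\<close>. At the right endpoint of each component of \<open>S\<^sub>s\<close> the
  distance is at least \<open>s\<close>, so that the one-sided condition, applied to the component as left half, bounds
  the average of \<open>w\<close> over it by a multiple of \<open>s\<^sup>-\<^sup>\<alpha>\<close>. Summing over the components gives a reverse Chebyshev
  inequality \<open>w(S\<^sub>s) \<le> K s\<^sup>-\<^sup>\<alpha> \<bar>S\<^sub>s\<bar>\<close> (\<open>emeasure_open_le_by_components\<close>), and this forces a decay of
  \<open>\<bar>S\<^sub>s\<bar>\<close> that is faster than \<open>s\<^sup>\<alpha>\<close> by a fixed power (\<open>self_improving_decay\<close>).

  Conversely, let \<open>\<beta> > \<alpha>\<close> be an admissible exponent. It is at most \<open>1\<close>, because \<open>E\<^sub>r\<close> contains an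
  interval of length \<open>r\<close> next to each point of \<open>E\<close>. The decay
  \<open>\<bar>I\<^sup>- \<inter> E\<^sub>r\<bar> \<le> C (r/d(x))\<^sup>\<beta> \<bar>I\<^sup>-\<bar>\<close>, known for intervals centred in \<open>E\<close>, then extends to all
  intervals: if \<open>I\<close> is far from \<open>E\<close>, then \<open>d\<close> is comparable to a constant on it, and otherwise \<open>I\<^sup>-\<close> is cut at the
  supremum of its points of \<open>E\<close>; the part to the left is covered by centred intervals, and the part to the right
  lies in a single gap, where \<open>E\<^sub>r\<close> has measure at most \<open>2r\<close> (\<open>nbhd_decay_all_intervals\<close>). Summing
  \<open>w\<close> over dyadic shells of \<open>d\<close> gives a geometric series with ratio \<open>2\<^sup>\<alpha>\<^sup>-\<^sup>\<beta> < 1\<close>, which is the \<open>A\<^sub>1\<^sup>+\<close> bound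
  (\<open>nn_integral_dist_weight_le\<close>).

  The degenerate case, in which \<open>E\<close> is dense in some interval, is excluded on both sides: there \<open>w\<close> is
  infinite on that interval, hence not locally integrable, and \<open>Mu\<^sub>1\<^sup>+(E) = 0\<close>.
\<close>

section \<open>Distance weights, neighbourhoods and gaps\<close>

lemma infdist_borel [measurable]: "(\<lambda>x::real. infdist x E) \<in> borel_measurable borel"
  by (intro borel_measurable_continuous_onI continuous_intros)

lemma nbhd_borel [measurable]: "nbhd E r \<in> sets borel"
  unfolding nbhd_def by simp

lemma nbhd_lebesgue [measurable]: "nbhd E r \<in> sets lebesgue"
  using nbhd_borel by simp

lemma nbhd_mono: "r \<le> s \<Longrightarrow> nbhd E r \<subseteq> nbhd E s"
  by (auto simp: nbhd_def)

lemma open_nbhd: "open (nbhd E r)"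
  unfolding nbhd_def by (intro open_Collect_less continuous_intros)

lemma dist_weight_borel [measurable]: "dist_weight E \<alpha> \<in> borel_measurable borel"
  unfolding dist_weight_def[abs_def] by measurable

lemma dist_weight_lebesgue [measurable]: "dist_weight E \<alpha> \<in> borel_measurable lebesgue"
  by (rule measurable_completion) (simp add: dist_weight_borel)

lemma dist_weight_pos: "dist_weight E \<alpha> x > 0"
  by (simp add: dist_weight_def)

lemma dist_weight_ge:
  assumes "0 < \<alpha>" "infdist x E \<le> r"
  shows "ennreal (r powr - \<alpha>) \<le> dist_weight E \<alpha> x"
proof (cases "infdist x E = 0")
  case False
  then have "0 < infdist x E"
    using infdist_nonneg[of x E] by linarith
  then show ?thesis
    using assms by (auto simp: dist_weight_def intro!: ennreal_leI powr_mono2')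
qed (simp add: dist_weight_def)

lemma dist_weight_le:
  assumes "0 < \<alpha>" "0 < r" "r \<le> infdist x E"
  shows "dist_weight E \<alpha> x \<le> ennreal (r powr - \<alpha>)"
  using assms by (auto simp: dist_weight_def intro!: ennreal_leI powr_mono2')

lemma inverse_dist_weight:
  assumes "0 < \<alpha>"
  shows "inverse (dist_weight E \<alpha> x) = ennreal (infdist x E powr \<alpha>)"
  using assms infdist_nonneg[of x E]
  by (auto simp: dist_weight_def inverse_ennreal powr_minus)

text \<open>For \<open>s = 1\<close> the constraint on the total length is void, so one interval competes as well as
  several do.\<close>

lemma gap_lengths_1:
  assumes "a < b"
  shows "gap_lengths 1 E a b =
    {l. l > 0 \<and> (\<exists>c d. c < d \<and> {c<..<d} \<subseteq> {a<..<b} - E \<and> l \<le> d - c)}"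
proof (intro set_eqI iffI)
  fix l assume "l \<in> gap_lengths 1 E a b"
  then obtain k c d where "l > 0" "k \<ge> (1::nat)"
    "\<forall>i<k. c i < d i \<and> {c i<..<d i} \<subseteq> {a<..<b} - E \<and> d i - c i \<ge> l"
    unfolding gap_lengths_def by blast
  then have "l > 0 \<and> c 0 < d 0 \<and> {c 0<..<d 0} \<subseteq> {a<..<b} - E \<and> l \<le> d 0 - c 0"
    by auto
  then show "l \<in> {l. l > 0 \<and> (\<exists>c d. c < d \<and> {c<..<d} \<subseteq> {a<..<b} - E \<and> l \<le> d - c)}"
    by blast
next
  fix l assume "l \<in> {l. l > 0 \<and> (\<exists>c d. c < d \<and> {c<..<d} \<subseteq> {a<..<b} - E \<and> l \<le> d - c)}"
  then obtain c d where *: "l > 0" "c < d" "{c<..<d} \<subseteq> {a<..<b} - E" "l \<le> d - c"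
    by blast
  show "l \<in> gap_lengths 1 E a b"
    unfolding gap_lengths_def mem_Collect_eq
    using * by (intro conjI exI[of _ "1::nat"] exI[of _ "\<lambda>_. c"] exI[of _ "\<lambda>_. d"])
      (auto simp: disjoint_family_on_def)
qed

lemma gap_length_le:
  fixes a b :: real
  assumes "a < b" "c < d" "{c<..<d} \<subseteq> {a<..<b} - E"
  shows "d - c \<le> b - a"
proof -
  have "{c<..<d} \<subseteq> {a<..<b}"
    using assms by blast
  then have "a \<le> c \<and> d \<le> b"
    using assms(1,2) greaterThanLessThan_subseteq_greaterThanLessThan[of c d a b] by simp
  then show ?thesis
    by simp
qed

lemma bdd_above_gap_lengths: "a < b \<Longrightarrow> bdd_above (gap_lengths 1 E a b)"
proof (rule bdd_aboveI[of _ "b - a"])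
  fix l assume "a < b" "l \<in> gap_lengths 1 E a b"
  then obtain c d where "c < d" "{c<..<d} \<subseteq> {a<..<b} - E" "l \<le> d - c"
    by (auto simp: gap_lengths_1)
  then show "l \<le> b - a"
    using gap_length_le[OF \<open>a < b\<close>] by fastforce
qed

lemma gap_L_ge:
  assumes "a < b" "c < d" "{c<..<d} \<subseteq> {a<..<b} - E"
  shows "d - c \<le> gap_L 1 E a b"
proof -
  have "d - c \<in> gap_lengths 1 E a b"
    using assms by (auto simp: gap_lengths_1)
  then show ?thesis
    using bdd_above_gap_lengths[OF assms(1)] by (auto simp: gap_L_def intro: cSup_upper)
qed

lemma gap_L_less:
  assumes "a < b" "0 \<le> t" "t < gap_L 1 E a b"
  obtains c d where "c < d" "{c<..<d} \<subseteq> {a<..<b} - E" "t < d - c"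
proof -
  have "gap_lengths 1 E a b \<noteq> {}" "t < Sup (gap_lengths 1 E a b)"
    using assms by (auto simp: gap_L_def split: if_splits)
  then obtain l where "l \<in> gap_lengths 1 E a b" "t < l"
    using less_cSupD by blast
  then obtain c d where "c < d" "{c<..<d} \<subseteq> {a<..<b} - E" "l \<le> d - c"
    using assms(1) by (auto simp: gap_lengths_1)
  then show ?thesis
    using that[of c d] \<open>t < l\<close> by simp
qed

lemma gap_L_nonneg: "a < b \<Longrightarrow> 0 \<le> gap_L 1 E a b"
proof (cases "gap_lengths 1 E a b = {}")
  case False
  assume "a < b"
  with False obtain c d where "c < d" "{c<..<d} \<subseteq> {a<..<b} - E"
    by (auto simp: gap_lengths_1)
  then show ?thesis
    using gap_L_ge[OF \<open>a < b\<close>, of c d E] by simp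
qed (simp add: gap_L_def)

lemma infdist_ball_avoids:
  assumes "\<bar>y - x\<bar> < infdist x E"
  shows "y \<notin> (E::real set)"
proof
  assume "y \<in> E"
  then have "infdist x E \<le> dist x y"
    by (rule infdist_le)
  then show False
    using assms by (simp add: dist_real_def)
qed

lemma infdist_in_gap:
  assumes "E \<noteq> {}" "{c<..<d} \<inter> E = {}" "y \<in> {c<..<d}"
  shows "min (y - c) (d - y) \<le> infdist y (E::real set)"
proof -
  have "min (y - c) (d - y) \<le> dist y e" if "e \<in> E" for e
  proof -
    have "e \<le> c \<or> d \<le> e"
      using that assms(2) by (meson disjoint_iff greaterThanLessThan_iff not_less)
    then show ?thesis
      by (auto simp: dist_real_def)
  qed
  then show ?thesis
    unfolding infdist_notempty[OF assms(1)] using assms(1) by (intro cINF_greatest) auto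
qed

text \<open>Both sides say that \<open>E\<close> is not dense in the interval.\<close>

lemma gap_L_pos_iff:
  assumes "a < b" "E \<noteq> {}"
  shows "0 < gap_L 1 E a b \<longleftrightarrow> (\<exists>x\<in>{a<..<b}. 0 < infdist x E)"
proof
  assume "0 < gap_L 1 E a b"
  then obtain c d where cd: "c < d" "{c<..<d} \<subseteq> {a<..<b} - E"
    using gap_L_less[OF assms(1), of 0 E] by blast
  define x where "x = (c + d) / 2"
  have x: "x \<in> {c<..<d}"
    using cd(1) by (auto simp: x_def)
  have "min (x - c) (d - x) \<le> infdist x E"
    using cd x assms(2) by (intro infdist_in_gap) auto
  then have "0 < infdist x E"
    using x by (auto simp: min_def split: if_splits)
  then show "\<exists>x\<in>{a<..<b}. 0 < infdist x E"
    using x cd by force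
next
  assume "\<exists>x\<in>{a<..<b}. 0 < infdist x E"
  then obtain x where x: "a < x" "x < b" "0 < infdist x E"
    by auto
  define y where "y = max a (x - infdist x E)"
  have "y < x"
    using x by (simp add: y_def)
  moreover have "{y<..<x} \<subseteq> {a<..<b} - E"
    using x infdist_ball_avoids[of _ x E] by (auto simp: y_def)
  ultimately have "x - y \<le> gap_L 1 E a b"
    by (rule gap_L_ge[OF assms(1)])
  then show "0 < gap_L 1 E a b"
    using \<open>y < x\<close> by simp
qed

lemma left_half_eq: "left_half (m - h) (m + h) = {m - h<..<m}" for m h :: real
  by (simp add: left_half_def)

lemma right_half_eq: "right_half (m - h) (m + h) = {m<..<m + h}" for m h :: real
  by (simp add: right_half_def)

lemma measure_Ioo_nbhd_le: "a \<le> b \<Longrightarrow> measure lebesgue ({a<..<b} \<inter> nbhd E r) \<le> b - a"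
  using measure_mono_fmeasurable[of "{a<..<b} \<inter> nbhd E r" "{a<..<b}" lebesgue] by simp

section \<open>Self-improvement of power decay\<close>

lemma powers_bracket:
  fixes q x :: real
  assumes "0 < q" "q < 1" "0 < x" "x < 1"
  obtains k where "q ^ Suc k \<le> x" "x < q ^ k"
proof -
  define n where "n = (LEAST n. q ^ n \<le> x)"
  have "\<exists>n. q ^ n \<le> x"
    using real_arch_pow_inv[OF assms(3,2)] less_imp_le by blast
  then have le: "q ^ n \<le> x"
    unfolding n_def by (rule LeastI_ex)
  then have "n \<noteq> 0"
    using assms(4) by (intro notI) simp
  then obtain k where k: "n = Suc k"
    using not0_implies_Suc by blast
  then have "\<not> q ^ k \<le> x"
    using not_less_Least[of k "\<lambda>n. q ^ n \<le> x"] by (simp add: n_def)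
  then show ?thesis
    using that[of k] le k by simp
qed

lemma powr_power_swap: "0 \<le> x \<Longrightarrow> (x ^ n) powr a = (x powr a) ^ n" for x :: real
  by (induction n) (simp_all add: powr_mult)

text \<open>A Gehring-type argument in its simplest form. In the application \<open>F s\<close> is the Lebesgue measure and
  \<open>W s\<close> the weighted measure of the set of points at distance less than \<open>s\<close> from \<open>E\<close>, so that the lower
  bound on \<open>W s\<close> is Chebyshev's inequality, the upper bound is the reverse inequality with constant
  \<open>K\<close>, and the increments satisfy Chebyshev's inequality as well. Shrink \<open>s\<close> by a factor
  \<open>\<theta>\<close>. By the reverse inequality, \<open>W s\<close> is at most \<open>K (W s - W (\<theta> s))\<close>, which comes from the shell, plus
  \<open>K s\<^sup>-\<^sup>\<alpha> F (\<theta> s) \<le> K \<theta>\<^sup>\<alpha> W (\<theta> s)\<close>. If \<open>K \<theta>\<^sup>\<alpha> = 1/2\<close>, rearranging yields \<open>W (\<theta> s) \<le> \<sigma> W s\<close> with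
  \<open>\<sigma> = (K - 1) / (K - 1/2) < 1\<close>. Hence \<open>W\<close> decays like a power \<open>s\<^sup>\<delta>\<close>, and \<open>F s \<le> s\<^sup>\<alpha> W s\<close> gains this power
  over \<open>s\<^sup>\<alpha>\<close>. Since \<open>\<delta>\<close> and \<open>C\<close> depend on \<open>\<alpha>\<close> and \<open>K\<close> alone, they can serve all intervals at once.\<close>

lemma self_improving_decay:
  fixes \<alpha> K :: real
  assumes "0 < \<alpha>" "1 < K"
  obtains \<delta> C where "0 < \<delta>" "1 \<le> C"
    "\<And>F W r0 r. 0 < r \<Longrightarrow> r \<le> r0 \<Longrightarrow>
      (\<And>s. 0 < s \<Longrightarrow> s \<le> r0 \<Longrightarrow> s powr - \<alpha> * F s \<le> W s \<and> W s \<le> K * (s powr - \<alpha> * F s)) \<Longrightarrow>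
      (\<And>s t. 0 < s \<Longrightarrow> s \<le> t \<Longrightarrow> t \<le> r0 \<Longrightarrow>
        F s \<le> F t \<and> t powr - \<alpha> * (F t - F s) \<le> W t - W s) \<Longrightarrow>
      F r \<le> C * (r / r0) powr (\<alpha> + \<delta>) * F r0"
proof -
  define \<theta> where "\<theta> = (2 * K) powr (- 1 / \<alpha>)"
  define \<sigma> where "\<sigma> = (K - 1) / (K - 1 / 2)"
  define \<delta> where "\<delta> = ln \<sigma> / ln \<theta>"
  have \<theta>: "0 < \<theta>" "\<theta> < 1"
    using assms by (auto simp: \<theta>_def powr_less_one)
  have \<theta>\<alpha>: "\<theta> powr \<alpha> = 1 / (2 * K)"
  proof -
    have "\<theta> powr \<alpha> = (2 * K) powr (- 1)"
      using assms unfolding \<theta>_def powr_powr by simp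
    then show ?thesis
      using assms by (simp add: powr_minus_divide)
  qed
  have \<sigma>: "0 < \<sigma>" "\<sigma> < 1"
    using assms by (auto simp: \<sigma>_def)
  have \<delta>: "0 < \<delta>"
    using \<theta> \<sigma> by (auto simp: \<delta>_def intro!: divide_neg_neg)
  have \<theta>\<delta>: "\<theta> powr \<delta> = \<sigma>"
    using \<theta> \<sigma> by (simp add: \<delta>_def powr_def)
  have \<sigma>1: "\<theta> powr - \<delta> \<ge> 1"
    using \<theta>\<delta> \<sigma> by (simp add: powr_minus one_le_inverse)
  define C where "C = K * \<theta> powr - \<delta>"
  have C: "C \<ge> 1"
    using mult_mono[of 1 K 1 "\<theta> powr - \<delta>"] \<sigma>1 assms by (simp add: C_def)
  have main: "F r \<le> C * (r / r0) powr (\<alpha> + \<delta>) * F r0"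
    if r: "0 < r" "r \<le> r0"
      and WF: "\<And>s. 0 < s \<Longrightarrow> s \<le> r0 \<Longrightarrow> s powr - \<alpha> * F s \<le> W s \<and> W s \<le> K * (s powr - \<alpha> * F s)"
      and incr: "\<And>s t. 0 < s \<Longrightarrow> s \<le> t \<Longrightarrow> t \<le> r0 \<Longrightarrow>
        F s \<le> F t \<and> t powr - \<alpha> * (F t - F s) \<le> W t - W s"
    for F W r0 r
  proof -
    have r0: "0 < r0"
      using r by simp
    have F_nonneg: "0 \<le> F s" if "0 < s" "s \<le> r0" for s
    proof -
      have "0 \<le> (K - 1) * (s powr - \<alpha> * F s)"
        using WF[OF that] by (simp add: algebra_simps)
      then have "0 \<le> s powr - \<alpha> * F s"
        using assms(2) by (simp add: zero_le_mult_iff)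
      moreover have "0 < s powr - \<alpha>"
        using that by simp
      ultimately show ?thesis
        by (simp add: zero_le_mult_iff)
    qed
    have W_mono: "W s \<le> W t" if "0 < s" "s \<le> t" "t \<le> r0" for s t
    proof -
      have "0 \<le> t powr - \<alpha> * (F t - F s)"
        using incr[OF that] by simp
      then show ?thesis
        using conjunct2[OF incr[OF that]] by linarith
    qed
    have step: "W (\<theta> * s) \<le> \<sigma> * W s" if s: "0 < s" "s \<le> r0" for s
    proof -
      have \<theta>s: "0 < \<theta> * s" "\<theta> * s \<le> s"
        using \<theta> s by auto
      have "(\<theta> * s) powr - \<alpha> = inverse (\<theta> powr \<alpha>) * s powr - \<alpha>"
        using s \<theta> by (simp add: powr_mult powr_minus)
      then have eq: "K * (s powr - \<alpha>) = (\<theta> * s) powr - \<alpha> / 2"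
        unfolding \<theta>\<alpha> using assms by simp
      have "W s \<le> K * (s powr - \<alpha> * (F s - F (\<theta> * s))) + K * (s powr - \<alpha>) * F (\<theta> * s)"
        using WF[OF s] by (simp add: algebra_simps)
      also have "\<dots> \<le> K * (W s - W (\<theta> * s)) + K * (s powr - \<alpha>) * F (\<theta> * s)"
        using incr[OF \<theta>s s(2)] assms by simp
      also have "K * (s powr - \<alpha>) * F (\<theta> * s) \<le> W (\<theta> * s) / 2"
        unfolding eq using WF[of "\<theta> * s"] \<theta>s s by simp
      finally have "(K - 1 / 2) * W (\<theta> * s) \<le> (K - 1) * W s"
        by (simp add: algebra_simps)
      then show ?thesis
        using assms by (simp add: \<sigma>_def field_simps)
    qed
    have iter: "W (r0 * \<theta> ^ k) \<le> \<sigma> ^ k * W r0" for k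
    proof (induction k)
      case (Suc k)
      have "0 < r0 * \<theta> ^ k" "r0 * \<theta> ^ k \<le> r0"
        using \<theta> r0 by (auto simp: power_le_one mult_le_cancel_left2)
      then have "W (\<theta> * (r0 * \<theta> ^ k)) \<le> \<sigma> * W (r0 * \<theta> ^ k)"
        by (rule step)
      also have "\<dots> \<le> \<sigma> * (\<sigma> ^ k * W r0)"
        using Suc \<sigma> by simp
      finally show ?case
        by (simp add: mult_ac)
    qed simp
    show ?thesis
    proof (cases "r = r0")
      case True
      then show ?thesis
        using C F_nonneg[of r0] r0 mult_right_mono[of 1 C "F r0"] by simp
    next
      case False
      then have "0 < r / r0" "r / r0 < 1"
        using r by auto
      then obtain k where k: "\<theta> ^ Suc k \<le> r / r0" "r / r0 < \<theta> ^ k"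
        using powers_bracket[OF \<theta>] by metis
      have "\<sigma> ^ k = (\<theta> ^ k) powr \<delta>"
        using \<theta> \<theta>\<delta> by (simp add: powr_power_swap)
      also have "\<dots> \<le> (r / r0 * inverse \<theta>) powr \<delta>"
      proof (rule powr_mono2)
        have "\<theta> ^ k = \<theta> ^ Suc k * inverse \<theta>"
          using \<theta> by simp
        also have "\<dots> \<le> r / r0 * inverse \<theta>"
          using k(1) \<theta> by (intro mult_right_mono) auto
        finally show "\<theta> ^ k \<le> r / r0 * inverse \<theta>" .
      qed (use \<theta> \<delta> in auto)
      also have "\<dots> = (r / r0) powr \<delta> * \<theta> powr - \<delta>"
        using \<theta> r r0 by (subst powr_mult) (auto simp: powr_minus inverse_powr)
      finally have \<sigma>k: "\<sigma> ^ k \<le> (r / r0) powr \<delta> * \<theta> powr - \<delta>" .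
      have rk: "r \<le> r0 * \<theta> ^ k" "r0 * \<theta> ^ k \<le> r0"
        using k r0 \<theta> by (auto simp: field_simps power_le_one mult_le_cancel_left2)
      have "F r = r powr \<alpha> * (r powr - \<alpha> * F r)"
        using r by (simp add: powr_minus)
      also have "\<dots> \<le> r powr \<alpha> * W r"
        using WF[OF r] by (intro mult_left_mono) auto
      also have "W r \<le> \<sigma> ^ k * W r0"
        using W_mono[OF r(1) rk] iter[of k] by linarith
      also have "\<sigma> ^ k * W r0
          \<le> ((r / r0) powr \<delta> * \<theta> powr - \<delta>) * (K * (r0 powr - \<alpha> * F r0))"
      proof (rule mult_mono[OF \<sigma>k])
        show "W r0 \<le> K * (r0 powr - \<alpha> * F r0)"
          using WF[of r0] r0 by simp
        have "0 \<le> r0 powr - \<alpha> * F r0"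
          using F_nonneg[of r0] r0 by simp
        then show "0 \<le> W r0"
          using WF[of r0] r0 by linarith
      qed simp
      finally have "F r \<le> r powr \<alpha> *
        (((r / r0) powr \<delta> * \<theta> powr - \<delta>) * (K * (r0 powr - \<alpha> * F r0)))"
        by (simp add: mult_left_mono)
      moreover have "(r / r0) powr (\<alpha> + \<delta>) = r powr \<alpha> * r0 powr - \<alpha> * (r / r0) powr \<delta>"
        using r r0 by (simp add: powr_add powr_divide powr_minus_divide)
      ultimately show ?thesis
        by (simp add: C_def mult_ac)
    qed
  qed
  show thesis
    by (rule that[OF \<delta> C main])
qed

section \<open>Measure bounds from the components of an open set\<close>

lemma component_of_open_real:
  fixes S :: "real set"
  assumes "open S" "bounded S" "C \<in> components S"
  obtains p q where "p < q" "C = {p<..<q}" "q \<notin> S"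
proof -
  have C: "open C" "connected C" "C \<noteq> {}" "C \<subseteq> S" "bounded C"
    using open_components[OF assms(1,3)] in_components_connected[OF assms(3)]
      in_components_nonempty[OF assms(3)] in_components_subset[OF assms(3)]
      bounded_subset[OF assms(2)] by simp_all
  define p q where "p = Inf C" and "q = Sup C"
  have bdd: "bdd_below C" "bdd_above C"
    using C(5) bounded_imp_bdd_below bounded_imp_bdd_above by auto
  have le: "p \<le> x" "x \<le> q" if "x \<in> C" for x
    using that bdd by (auto simp: p_def q_def cInf_lower cSup_upper)
  have notin: "p \<notin> C" "q \<notin> C"
  proof -
    show "p \<notin> C"
    proof
      assume "p \<in> C"
      then obtain e where "0 < e" "ball p e \<subseteq> C"
        using C(1) openE by blast
      then have "p - e / 2 \<in> C"
        by (auto simp: subset_iff dist_real_def)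
      then show False
        using le(1)[of "p - e / 2"] \<open>0 < e\<close> by simp
    qed
    show "q \<notin> C"
    proof
      assume "q \<in> C"
      then obtain e where "0 < e" "ball q e \<subseteq> C"
        using C(1) openE by blast
      then have "q + e / 2 \<in> C"
        by (auto simp: subset_iff dist_real_def)
      then show False
        using le(2)[of "q + e / 2"] \<open>0 < e\<close> by simp
    qed
  qed
  have C_eq: "C = {p<..<q}"
  proof (intro equalityI subsetI)
    fix x assume "x \<in> C"
    then have "x \<noteq> p" "x \<noteq> q"
      using notin by blast+
    then show "x \<in> {p<..<q}"
      using le[OF \<open>x \<in> C\<close>] by auto
  next
    fix x assume x: "x \<in> {p<..<q}"
    obtain y where "y \<in> C" "y < x"
      using cInf_lessD[of C x] C(3) x by (auto simp: p_def)
    moreover obtain z where "z \<in> C" "x < z"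
      using less_cSupD[of C x] C(3) x by (auto simp: q_def)
    ultimately show "x \<in> C"
      using C(2) connected_contains_Icc[of C y z] by auto
  qed
  with C(3) have "p < q"
    by auto
  moreover have "q \<notin> S"
  proof
    assume "q \<in> S"
    then have "{p<..q} \<subseteq> C"
    proof (intro components_maximal[OF assms(3)])
      show "{p<..q} \<subseteq> S"
        using \<open>q \<in> S\<close> C_eq C(4) by (auto simp: less_le)
      have "(p + q) / 2 \<in> C \<inter> {p<..q}"
        using C_eq \<open>p < q\<close> by auto
      then show "C \<inter> {p<..q} \<noteq> {}"
        by blast
    qed simp
    then show False
      using notin \<open>p < q\<close> by auto
  qed
  ultimately show ?thesis
    using that C_eq by blast
qed

text \<open>Only components of \<open>S\<close> have to be controlled, and these are open intervals whose right endpoint lies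
  outside \<open>S\<close>. It is this endpoint condition that gives the one-sided hypothesis its force.\<close>

lemma emeasure_open_le_by_components:
  fixes S :: "real set"
  assumes S: "open S" "bounded S"
    and sets: "sets M = sets lebesgue"
    and le: "\<And>p q. p < q \<Longrightarrow> {p<..<q} \<subseteq> S \<Longrightarrow> q \<notin> S \<Longrightarrow> emeasure M {p<..<q} \<le> c * ennreal (q - p)"
  shows "emeasure M S \<le> c * emeasure lebesgue S"
proof -
  have op: "open C" if "C \<in> components S" for C
    using that S(1) open_components by blast
  have disj: "disjoint_family_on (\<lambda>C. C) (components S)"
    using pairwise_disjoint_components[of S] by (simp add: disjoint_family_on_def pairwise_def)
  have cnt: "countable (components S)"
    using op pairwise_disjoint_components[of S]
    by (intro countable_disjoint_open_subsets) (auto simp: pairwise_def disjnt_def)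
  have comp: "emeasure M C \<le> c * emeasure lebesgue C" if C: "C \<in> components S" for C
  proof -
    obtain p q where pq: "p < q" "C = {p<..<q}" "q \<notin> S"
      using component_of_open_real[OF S C] by metis
    then have "emeasure M C \<le> c * ennreal (q - p)"
      using in_components_subset[OF C] by (auto intro!: le)
    then show ?thesis
      using pq by simp
  qed
  have sum: "emeasure N S = (\<integral>\<^sup>+C. emeasure N C \<partial>count_space (components S))"
    if "sets N = sets lebesgue" for N
    using emeasure_UN_countable[of "components S" "\<lambda>C. C" N] op cnt disj that by simp
  have "emeasure M S \<le> (\<integral>\<^sup>+C. c * emeasure lebesgue C \<partial>count_space (components S))"
    unfolding sum[OF sets] using comp by (intro nn_integral_mono) simp
  also have "\<dots> = c * emeasure lebesgue S"
    by (simp add: nn_integral_cmult sum)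
  finally show ?thesis .
qed

section \<open>An admissible exponent beyond that of an A1 weight\<close>

text \<open>The interval with left half \<open>(p,q)\<close> has \<open>q\<close> as the left endpoint of its right half. Points just right of
  \<open>q\<close> have distance nearly \<open>d(q) \<ge> r\<close> from \<open>E\<close>, so the essential supremum of \<open>d\<^sup>\<alpha>\<close> over the right half
  is at least \<open>r\<^sup>\<alpha>\<close>.\<close>

lemma A1_plus_left_average:
  assumes A1: "A1_plus (dist_weight E \<alpha>)" and \<alpha>: "0 < \<alpha>"
  obtains K where "1 < K" "\<And>p q r. p < q \<Longrightarrow> 0 < r \<Longrightarrow> r \<le> infdist q E \<Longrightarrow>
    emeasure (density lebesgue (dist_weight E \<alpha>)) {p<..<q} \<le> ennreal (K * r powr - \<alpha>) * ennreal (q - p)"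
proof -
  let ?w = "dist_weight E \<alpha>"
  let ?quot = "\<lambda>a b. ((\<integral>\<^sup>+x\<in>left_half a b. ?w x \<partial>lebesgue) / emeasure lebesgue (left_half a b))
            * esssup (restrict_space lebesgue (right_half a b)) (\<lambda>x. inverse (?w x))"
  have "Sup {?quot a b | a b. a < b} < \<infinity>"
    using A1 unfolding A1_plus_def by blast
  then obtain K0 where K0: "Sup {?quot a b | a b. a < b} = ennreal K0"
    by (cases "Sup {?quot a b | a b. a < b}") auto
  \<comment> \<open>The maximum ensures \<open>K > 1\<close>, which makes the ratio \<open>(K - 1) / (K - 1/2)\<close> of the decay argument positive.\<close>
  define K where "K = max 2 K0"
  have K: "1 < K"
    by (simp add: K_def)
  have quot: "?quot a b \<le> ennreal K" if "a < b" for a b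
  proof -
    have "?quot a b \<le> Sup {?quot a b | a b. a < b}"
      using that by (intro Sup_upper) blast
    also have "\<dots> \<le> ennreal K"
      unfolding K0 by (intro ennreal_leI) (simp add: K_def)
    finally show ?thesis .
  qed
  have "emeasure (density lebesgue ?w) {p<..<q} \<le> ennreal (K * r powr - \<alpha>) * ennreal (q - p)"
    if pq: "p < q" and r: "0 < r" "r \<le> infdist q E" for p q r
  proof -
    define h where "h = q - p"
    have h: "0 < h" and p: "p = q - h"
      using pq by (auto simp: h_def)
    let ?X = "emeasure (density lebesgue ?w) {p<..<q}"
    let ?S = "esssup (restrict_space lebesgue {q<..<q + h}) (\<lambda>x. inverse (?w x))"
    have X: "?X = (\<integral>\<^sup>+x\<in>{p<..<q}. ?w x \<partial>lebesgue)"
      by (simp add: emeasure_density)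
    have "?quot (q - h) (q + h) = ?X / ennreal h * ?S"
      unfolding X unfolding p left_half_eq right_half_eq using h by simp
    then have XS: "?X / ennreal h * ?S \<le> ennreal K"
      using quot[of "q - h" "q + h"] h by simp
    have S: "ennreal (r powr \<alpha>) \<le> ?S"
    proof (rule ccontr)
      assume "\<not> ennreal (r powr \<alpha>) \<le> ?S"
      then have "?S < ennreal (r powr \<alpha>)"
        by (simp add: not_le)
      also have "\<dots> \<le> ennreal (infdist q E powr \<alpha>)"
        using r \<alpha> by (intro ennreal_leI powr_mono2) auto
      finally have less: "?S < ennreal (infdist q E powr \<alpha>)" .
      have "((\<lambda>x. ennreal (infdist x E powr \<alpha>)) \<longlongrightarrow> ennreal (infdist q E powr \<alpha>)) (at_right q)"
        using r by (intro tendsto_ennrealI tendsto_powr tendsto_infdist tendsto_const tendsto_ident_at) auto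
      then have "\<forall>\<^sub>F x in at_right q. ?S < ennreal (infdist x E powr \<alpha>)"
        using less by (rule order_tendstoD)
      then obtain t where t: "q < t" "\<And>x. q < x \<Longrightarrow> x < t \<Longrightarrow> ?S < ennreal (infdist x E powr \<alpha>)"
        unfolding eventually_at_right_field by blast
      define u where "u = min t (q + h)"
      have u: "q < u"
        using t h by (simp add: u_def)
      have "AE x in restrict_space lebesgue {q<..<q + h}. inverse (?w x) \<le> ?S"
        by (rule esssup_AE)
      then have "AE x in lebesgue. x \<in> {q<..<q + h} \<longrightarrow> inverse (?w x) \<le> ?S"
        by (simp add: AE_restrict_space_iff)
      then have "AE x in lebesgue. x \<notin> {q<..<u}"
      proof eventually_elim
        case (elim x)
        show ?case
        proof
          assume "x \<in> {q<..<u}"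
          then have "?S < inverse (?w x)" "x \<in> {q<..<q + h}"
            using t(2)[of x] by (auto simp: u_def inverse_dist_weight[OF \<alpha>])
          then show False
            using elim by (simp add: not_le[symmetric])
        qed
      qed
      then have "{q<..<u} \<in> null_sets lebesgue"
        by (subst AE_iff_null_sets) auto
      then have "emeasure lebesgue {q<..<u} = 0"
        by (rule null_setsD1)
      then show False
        using u by simp
    qed
    have hne: "ennreal h \<noteq> 0"
      using h by simp
    have "?X = ?X / ennreal h * ennreal h"
      using hne by (simp add: ennreal_divide_times ennreal_divide_self)
    also have "?X / ennreal h = ?X / ennreal h * ennreal (r powr \<alpha>) * ennreal (r powr - \<alpha>)"
      using r by (simp add: mult.assoc powr_minus flip: ennreal_mult)
    also have "?X / ennreal h * ennreal (r powr \<alpha>) \<le> ennreal K"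
      using mult_left_mono[OF S, of "?X / ennreal h"] XS by simp
    also have "ennreal K * ennreal (r powr - \<alpha>) = ennreal (K * r powr - \<alpha>)"
      using K by (simp add: ennreal_mult)
    finally show ?thesis
      by (simp add: h_def mult_right_mono)
  qed
  with K that show ?thesis
    by blast
qed

text \<open>If \<open>E\<close> were dense in an interval, the weight would be infinite on it and not locally integrable.\<close>

lemma A1_plus_gap_pos:
  assumes A1: "A1_plus (dist_weight E \<alpha>)" and E: "E \<noteq> {}" and ab: "a < b"
  shows "0 < gap_L 1 E a b"
proof (rule ccontr)
  assume "\<not> 0 < gap_L 1 E a b"
  then have zero: "infdist x E = 0" if "x \<in> {a<..<b}" for x
    using that gap_L_pos_iff[OF ab E] infdist_nonneg[of x E] by force
  have "(\<integral>\<^sup>+x. top * indicator {a<..<b} x \<partial>lebesgue) \<le> (\<integral>\<^sup>+x\<in>{a..b}. dist_weight E \<alpha> x \<partial>lebesgue)"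
    by (intro nn_integral_mono) (auto simp: indicator_def dist_weight_def zero)
  moreover have "(\<integral>\<^sup>+x. top * indicator {a<..<b} x \<partial>lebesgue) = top"
    using ab by (subst nn_integral_cmult_indicator) (auto simp: ennreal_top_mult)
  ultimately show False
    using A1 unfolding A1_plus_def weight_def locally_integrable_def
    by (metis compact_Icc infinity_ennreal_def top.not_eq_extremum top_le)
qed

text \<open>This is the self-improvement step: Chebyshev's inequality alone would give the exponent \<open>\<alpha>\<close>. The
  reverse inequality needed for \<open>self_improving_decay\<close> comes from the components of
  \<open>{x \<in> (p,q). d(x) < s}\<close>: the right endpoint of a component is either \<open>q\<close> or a point of \<open>(p,q)\<close> with
  \<open>d \<ge> s\<close>, and \<open>d(q) \<ge> s\<close> by assumption, so the average of the weight over each component is controlled.\<close>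

lemma A1_plus_nbhd_decay:
  assumes A1: "A1_plus (dist_weight E \<alpha>)" and \<alpha>: "0 < \<alpha>"
  obtains \<delta> C where "0 < \<delta>" "1 \<le> C"
    "\<And>p q r. p < q \<Longrightarrow> 0 < r \<Longrightarrow> r \<le> infdist q E \<Longrightarrow>
      measure lebesgue ({p<..<q} \<inter> nbhd E r) \<le> C * (r / infdist q E) powr (\<alpha> + \<delta>) * (q - p)"
proof -
  let ?D = "density lebesgue (dist_weight E \<alpha>)"
  obtain K where K: "1 < K" and avg: "\<And>p q r. p < q \<Longrightarrow> 0 < r \<Longrightarrow> r \<le> infdist q E \<Longrightarrow>
    emeasure ?D {p<..<q} \<le> ennreal (K * r powr - \<alpha>) * ennreal (q - p)"
    by (fact A1_plus_left_average[OF A1 \<alpha>])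
  obtain \<delta> C where \<delta>C: "0 < \<delta>" "1 \<le> C" and decay:
    "\<And>F W r0 r. 0 < r \<Longrightarrow> r \<le> r0 \<Longrightarrow>
      (\<And>s. 0 < s \<Longrightarrow> s \<le> r0 \<Longrightarrow> s powr - \<alpha> * F s \<le> W s \<and> W s \<le> K * (s powr - \<alpha> * F s)) \<Longrightarrow>
      (\<And>s t. 0 < s \<Longrightarrow> s \<le> t \<Longrightarrow> t \<le> r0 \<Longrightarrow>
        F s \<le> F t \<and> t powr - \<alpha> * (F t - F s) \<le> W t - W s) \<Longrightarrow>
      F r \<le> C * (r / r0) powr (\<alpha> + \<delta>) * F r0"
    by (fact self_improving_decay[OF \<alpha> K])
  have "measure lebesgue ({p<..<q} \<inter> nbhd E r) \<le> C * (r / infdist q E) powr (\<alpha> + \<delta>) * (q - p)"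
    if pq: "p < q" and r: "0 < r" "r \<le> infdist q E" for p q r
  proof -
    define r0 where "r0 = infdist q E"
    define S where "S s = {p<..<q} \<inter> nbhd E s" for s
    define F where "F s = measure lebesgue (S s)" for s
    define W where "W s = measure ?D (S s)" for s
    have S_meas [measurable]: "S s \<in> sets lebesgue" for s
      by (simp add: S_def)
    have S_mono: "S s \<subseteq> S t" if "s \<le> t" for s t
      using nbhd_mono[OF that] by (auto simp: S_def)
    have S_fin: "emeasure lebesgue (S s) \<noteq> top" for s
    proof -
      have "emeasure lebesgue (S s) \<le> emeasure lebesgue {p<..<q}"
        by (intro emeasure_mono) (auto simp: S_def)
      then show ?thesis
        using pq by (auto simp: top_unique)
    qed
    have F_eq: "emeasure lebesgue (S s) = ennreal (F s)" for s
      unfolding F_def by (rule emeasure_eq_ennreal_measure[OF S_fin])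
    have W_le: "emeasure ?D (S s) \<le> ennreal (K * (s powr - \<alpha> * F s))" if s: "0 < s" "s \<le> r0" for s
    proof -
      have "emeasure ?D (S s) \<le> ennreal (K * s powr - \<alpha>) * emeasure lebesgue (S s)"
      proof (rule emeasure_open_le_by_components)
        show "open (S s)" "bounded (S s)"
          by (auto simp: S_def open_nbhd intro: bounded_subset[OF compact_imp_bounded[OF compact_Icc[of p q]]])
        fix p' q' assume *: "p' < q'" "{p'<..<q'} \<subseteq> S s" "q' \<notin> S s"
        then have "{p'<..<q'} \<subseteq> {p<..<q}"
          by (auto simp: S_def)
        then have "p \<le> p'" "q' \<le> q"
          using *(1) by (simp_all add: greaterThanLessThan_subseteq_greaterThanLessThan)
        then have "s \<le> infdist q' E"
          using * s by (cases "q' = q") (auto simp: S_def nbhd_def r0_def)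
        then show "emeasure ?D {p'<..<q'} \<le> ennreal (K * s powr - \<alpha>) * ennreal (q' - p')"
          using avg[OF *(1) s(1)] by simp
      qed simp
      also have "\<dots> = ennreal (K * (s powr - \<alpha> * F s))"
        using K by (simp add: F_eq F_def mult.assoc flip: ennreal_mult)
      finally show ?thesis .
    qed
    then have W_fin: "emeasure ?D (S s) \<noteq> top" if "0 < s" "s \<le> r0" for s
      using that by (metis ennreal_neq_top top_le)
    have W_ge: "t powr - \<alpha> * measure lebesgue B \<le> measure ?D B"
      if "0 < t" "t \<le> r0" "B \<subseteq> S t" and [measurable]: "B \<in> sets lebesgue" for t B
    proof -
      have "ennreal (t powr - \<alpha>) * emeasure lebesgue B = (\<integral>\<^sup>+x. ennreal (t powr - \<alpha>) * indicator B x \<partial>lebesgue)"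
        by (simp add: nn_integral_cmult_indicator)
      also have "\<dots> \<le> (\<integral>\<^sup>+x. dist_weight E \<alpha> x * indicator B x \<partial>lebesgue)"
        using that by (intro nn_integral_mono)
          (auto simp: indicator_def S_def nbhd_def less_imp_le intro!: dist_weight_ge[OF \<alpha>])
      also have "\<dots> = emeasure ?D B"
        by (simp add: emeasure_density)
      finally have le: "ennreal (t powr - \<alpha>) * emeasure lebesgue B \<le> emeasure ?D B" .
      have "emeasure ?D B \<le> emeasure ?D (S t)" "emeasure lebesgue B \<le> emeasure lebesgue (S t)"
        using emeasure_mono[OF that(3), of ?D] emeasure_mono[OF that(3), of lebesgue] by simp_all
      then have "emeasure ?D B \<noteq> top" "emeasure lebesgue B \<noteq> top"
        using W_fin[of t] S_fin[of t] that by (auto simp: top_unique)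
      then have "ennreal (t powr - \<alpha> * measure lebesgue B) \<le> ennreal (measure ?D B)"
        using le by (simp add: emeasure_eq_ennreal_measure ennreal_mult)
      then show ?thesis
        by simp
    qed
    have "F r \<le> C * (r / r0) powr (\<alpha> + \<delta>) * F r0"
    proof (rule decay)
      fix s assume s: "0 < s" "s \<le> r0"
      show "s powr - \<alpha> * F s \<le> W s \<and> W s \<le> K * (s powr - \<alpha> * F s)"
      proof
        show "s powr - \<alpha> * F s \<le> W s"
          using W_ge[OF s order_refl] by (simp add: F_def W_def)
        have "0 \<le> K * (s powr - \<alpha> * F s)"
          using K by (simp add: F_def)
        moreover have "ennreal (W s) \<le> ennreal (K * (s powr - \<alpha> * F s))"
          using W_le[OF s] W_fin[OF s] by (simp add: W_def emeasure_eq_ennreal_measure)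
        ultimately show "W s \<le> K * (s powr - \<alpha> * F s)"
          by simp
      qed
    next
      fix s t assume st: "0 < s" "s \<le> t" "t \<le> r0"
      show "F s \<le> F t \<and> t powr - \<alpha> * (F t - F s) \<le> W t - W s"
      proof
        have t: "0 < t"
          using st by simp
        have diff: "F t - F s = measure lebesgue (S t - S s)" "W t - W s = measure ?D (S t - S s)"
          using S_fin[of t] W_fin[OF t st(3)] S_mono[OF st(2)]
          by (simp_all add: F_def W_def measure_Diff)
        show "F s \<le> F t"
          using diff(1) measure_nonneg[of lebesgue "S t - S s"] by linarith
        show "t powr - \<alpha> * (F t - F s) \<le> W t - W s"
          unfolding diff by (intro W_ge[OF t st(3)]) auto
      qed
    qed (use r in \<open>auto simp: r0_def\<close>)
    also have "F r0 \<le> q - p"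
    proof -
      have "F r0 \<le> measure lebesgue {p<..<q}"
        unfolding F_def using pq by (intro measure_mono_fmeasurable) (auto simp: S_def)
      then show ?thesis
        using pq by simp
    qed
    finally show ?thesis
      using \<delta>C by (simp add: F_def S_def r0_def mult_left_mono)
  qed
  with \<delta>C that show ?thesis
    by blast
qed

text \<open>For an interval centred at \<open>m\<close> with a gap of length \<open>l > L/2\<close> in its right half, the previous decay
  is applied to the interval from the left endpoint to the midpoint \<open>x\<close> of the gap, where
  \<open>d(x) \<ge> l/2 > L/4\<close>.\<close>

lemma A1_plus_larger_exponent:
  assumes A1: "A1_plus (dist_weight E \<alpha>)" and \<alpha>: "0 < \<alpha>" and E: "E \<noteq> {}"
  obtains \<beta> where "\<alpha> < \<beta>" "\<beta> \<in> Mu1_plus_exponents E"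
proof -
  obtain \<delta> C where \<delta>: "0 < \<delta>" and C: "1 \<le> C" and decay:
    "\<And>p q r. p < q \<Longrightarrow> 0 < r \<Longrightarrow> r \<le> infdist q E \<Longrightarrow>
      measure lebesgue ({p<..<q} \<inter> nbhd E r) \<le> C * (r / infdist q E) powr (\<alpha> + \<delta>) * (q - p)"
    by (fact A1_plus_nbhd_decay[OF A1 \<alpha>])
  define \<beta> where "\<beta> = \<alpha> + \<delta>"
  have \<beta>: "0 < \<beta>"
    using \<alpha> \<delta> by (simp add: \<beta>_def)
  define C' where "C' = 2 * C * 4 powr \<beta>"
  have "measure lebesgue (left_half a b \<inter> nbhd E r) / measure lebesgue (left_half a b)
      \<le> C' * (r / gap_L 1 E ((a + b) / 2) b) powr \<beta>"
    if ab: "a < b" and r: "0 < r" "r \<le> gap_L 1 E ((a + b) / 2) b" for a b r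
  proof -
    define m h where "m = (a + b) / 2" and "h = (b - a) / 2"
    have h: "0 < h" and a: "a = m - h" and b: "b = m + h"
      using ab by (auto simp: m_def h_def field_simps)
    define L where "L = gap_L 1 E m b"
    have L: "0 < L" "r \<le> L"
      using r by (auto simp: L_def m_def)
    obtain c d where cd: "c < d" "{c<..<d} \<subseteq> {m<..<b} - E" "L / 2 < d - c"
      using gap_L_less[of m b "L / 2" E] L h b by (auto simp: L_def)
    define x where "x = (c + d) / 2"
    have "x \<in> {c<..<d}"
      using cd by (auto simp: x_def)
    then have x: "m < x" "x < b"
      using cd by auto
    have "min (x - c) (d - x) \<le> infdist x E"
      using \<open>x \<in> {c<..<d}\<close> cd E by (intro infdist_in_gap) auto
    then have Lx: "L / 4 < infdist x E"
      using cd(3) by (auto simp: x_def min_def field_simps split: if_splits)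
    have "measure lebesgue ({a<..<m} \<inter> nbhd E r) \<le> C' * (r / L) powr \<beta> * h"
    proof (cases "r \<le> infdist x E")
      case True
      have "measure lebesgue ({a<..<m} \<inter> nbhd E r) \<le> measure lebesgue ({a<..<x} \<inter> nbhd E r)"
        using x by (intro measure_mono_fmeasurable fmeasurable_Int_fmeasurable) auto
      also have "\<dots> \<le> C * (r / infdist x E) powr \<beta> * (x - a)"
        unfolding \<beta>_def using True r x h a by (intro decay) auto
      also have "\<dots> \<le> C * (r / (L / 4)) powr \<beta> * (2 * h)"
        using C L Lx r x a b h \<beta> by (intro mult_mono powr_mono2 divide_left_mono) auto
      also have "\<dots> = C' * (r / L) powr \<beta> * h"
        using L r by (simp add: C'_def powr_mult powr_divide)
      finally show ?thesis .
    next
      case False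
      \<comment> \<open>Now \<open>r > L/4\<close>, and the bound is trivial.\<close>
      then have "1 \<le> 4 * (r / L)"
        using Lx L by (simp add: field_simps)
      then have "1 \<le> (4 * (r / L)) powr \<beta>"
        using \<beta> by (simp add: ge_one_powr_ge_zero)
      also have "\<dots> = 4 powr \<beta> * (r / L) powr \<beta>"
        using r L by (intro powr_mult)
      finally have one: "1 \<le> 4 powr \<beta> * (r / L) powr \<beta>" .
      have "1 * 1 \<le> (2 * C) * (4 powr \<beta> * (r / L) powr \<beta>)"
        using C one by (intro mult_mono) auto
      then have "1 \<le> C' * (r / L) powr \<beta>"
        by (simp add: C'_def mult_ac)
      have "measure lebesgue ({a<..<m} \<inter> nbhd E r) \<le> measure lebesgue {a<..<m}"
        by (intro measure_mono_fmeasurable) auto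
      also have "\<dots> = 1 * h"
        using h a by simp
      also have "\<dots> \<le> C' * (r / L) powr \<beta> * h"
        using \<open>1 \<le> C' * (r / L) powr \<beta>\<close> h by (intro mult_right_mono) auto
      finally show ?thesis .
    qed
    then have "measure lebesgue ({a<..<m} \<inter> nbhd E r) / h \<le> C' * (r / L) powr \<beta>"
      using h by (simp add: field_simps)
    moreover have "measure lebesgue {a<..<m} = h"
      using h a by simp
    ultimately show ?thesis
      by (simp add: left_half_def L_def m_def)
  qed
  moreover have "0 < C'"
    using C by (simp add: C'_def)
  ultimately have "\<beta> \<in> Mu1_plus_exponents E"
    using \<beta> unfolding Mu1_plus_exponents_def by auto
  then show ?thesis
    using that[of \<beta>] \<delta> by (simp add: \<beta>_def)
qed

section \<open>The A1 condition below an admissible exponent\<close>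

text \<open>Layer-cake estimate: up to the factor \<open>2\<^sup>\<alpha>\<close>, the weight is the constant \<open>(2\<^sup>-\<^sup>k L)\<^sup>-\<^sup>\<alpha>\<close> on the shell where
  \<open>d\<close> is between \<open>2\<^sup>-\<^sup>k\<^sup>-\<^sup>1 L\<close> and \<open>2\<^sup>-\<^sup>k L\<close>, and the measure of that shell decays like \<open>2\<^sup>-\<^sup>k\<^sup>\<beta>\<close>. The shells
  contribute a geometric series with ratio \<open>2\<^sup>\<alpha>\<^sup>-\<^sup>\<beta>\<close>; the leading \<open>1\<close> accounts for the points with \<open>d \<ge> L\<close>.\<close>

lemma nn_integral_dist_weight_le:
  assumes \<alpha>\<beta>: "0 < \<alpha>" "\<alpha> < \<beta>" and L: "0 < L" and C: "0 \<le> C" and M: "0 \<le> M"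
    and A[measurable]: "A \<in> sets lebesgue" and A_M: "emeasure lebesgue A = ennreal M"
    and le: "\<And>r. 0 < r \<Longrightarrow> r \<le> L \<Longrightarrow> measure lebesgue (A \<inter> nbhd E r) \<le> C * (r / L) powr \<beta> * M"
  shows "(\<integral>\<^sup>+x\<in>A. dist_weight E \<alpha> x \<partial>lebesgue)
    \<le> ennreal ((1 + C * 2 powr \<alpha> / (1 - 2 powr (\<alpha> - \<beta>))) * L powr - \<alpha> * M)"
proof -
  define r where "r k = L * (1 / 2) ^ k" for k :: nat
  define c where "c k = L powr - \<alpha> * (2 powr \<alpha>) ^ Suc k" for k :: nat
  have r_pos: "0 < r k" and r_le: "r k \<le> L" for k
    using L by (auto simp: r_def power_le_one)
  have two: "1 \<le> 2 powr \<alpha>"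
    using \<alpha>\<beta> by (simp add: ge_one_powr_ge_zero)
  have c_nonneg: "0 \<le> c k" for k
    by (simp add: c_def)
  have half_nonneg: "0 \<le> (1 / 2 :: real)"
    by simp
  have c_eq: "(r (Suc k)) powr - \<alpha> = c k" for k
  proof -
    have "((1 / 2 :: real) ^ Suc k) powr - \<alpha> = (2 powr \<alpha>) ^ Suc k"
      unfolding powr_power_swap[OF half_nonneg] by (simp add: powr_minus powr_divide)
    then show ?thesis
      using L by (simp add: r_def c_def powr_mult del: power_Suc)
  qed
  have pointwise: "dist_weight E \<alpha> x
      \<le> ennreal (L powr - \<alpha>) + (\<Sum>k. ennreal (c k) * indicator (nbhd E (r k)) x)" for x
  proof -
    have term_le: "ennreal (c k) \<le> (\<Sum>k. ennreal (c k) * indicator (nbhd E (r k)) x)"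
      if "infdist x E < r k" for k
    proof -
      have "ennreal (c k) = (\<Sum>k\<in>{k}. ennreal (c k) * indicator (nbhd E (r k)) x)"
        using that by (simp add: nbhd_def)
      also have "\<dots> \<le> (\<Sum>k. ennreal (c k) * indicator (nbhd E (r k)) x)"
        by (intro sum_le_suminf) auto
      finally show ?thesis .
    qed
    consider "infdist x E = 0" | "0 < infdist x E" "infdist x E < L" | "L \<le> infdist x E"
      using infdist_nonneg[of x E] by linarith
    then show ?thesis
    proof cases
      \<comment> \<open>On the closure of \<open>E\<close> both sides are infinite, because the terms of the series do not tend to \<open>0\<close>.\<close>
      case 1
      then have "(\<Sum>k. ennreal (c k) * indicator (nbhd E (r k)) x) = (\<Sum>k. ennreal (c k))"
        using r_pos by (simp add: nbhd_def)
      also have "\<dots> = top"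
      proof (rule ccontr)
        assume "(\<Sum>k. ennreal (c k)) \<noteq> top"
        then have "summable c"
          using summable_suminf_not_top c_nonneg by blast
        then have lim: "c \<longlonglongrightarrow> 0"
          by (rule summable_LIMSEQ_zero)
        have "L powr - \<alpha> \<le> c k" for k
          using mult_left_mono[OF one_le_power[OF two, of "Suc k"], of "L powr - \<alpha>"] by (simp add: c_def)
        then have "L powr - \<alpha> \<le> 0"
          by (intro LIMSEQ_le_const[OF lim]) auto
        then show False
          using L by simp
      qed
      finally show ?thesis
        by simp
    next
      case 2
      then have "0 < infdist x E / L" "infdist x E / L < 1"
        using L by auto
      then obtain k where "(1 / 2) ^ Suc k \<le> infdist x E / L" "infdist x E / L < (1 / 2) ^ k"
        using powers_bracket[of "1 / 2" "infdist x E / L"] by auto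
      then have k: "r (Suc k) \<le> infdist x E" "infdist x E < r k"
        using L by (simp_all add: r_def pos_le_divide_eq pos_divide_less_eq mult.commute)
      have "dist_weight E \<alpha> x \<le> ennreal (c k)"
        using dist_weight_le[OF \<alpha>\<beta>(1) r_pos k(1)] by (simp add: c_eq)
      also note term_le[OF k(2)]
      finally show ?thesis
        by (simp add: add_increasing)
    next
      case 3
      then show ?thesis
        using dist_weight_le[OF \<alpha>\<beta>(1) L] by (simp add: add_increasing2)
    qed
  qed
  define \<rho> where "\<rho> = 2 powr (\<alpha> - \<beta>)"
  have \<rho>: "0 < \<rho>" "\<rho> < 1"
    using \<alpha>\<beta> powr_less_mono[of "\<alpha> - \<beta>" 0 2] by (auto simp: \<rho>_def)
  define B where "B = C * 2 powr \<alpha> * L powr - \<alpha> * M"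
  have B: "0 \<le> B"
    using C M by (simp add: B_def)
  have shell: "ennreal (c k) * emeasure lebesgue (A \<inter> nbhd E (r k)) \<le> ennreal (B * \<rho> ^ k)" for k
  proof -
    have "emeasure lebesgue (A \<inter> nbhd E (r k)) \<le> emeasure lebesgue A"
      by (intro emeasure_mono) auto
    then have "emeasure lebesgue (A \<inter> nbhd E (r k)) \<noteq> top"
      using A_M by (auto simp: top_unique)
    then have "emeasure lebesgue (A \<inter> nbhd E (r k)) = ennreal (measure lebesgue (A \<inter> nbhd E (r k)))"
      by (rule emeasure_eq_ennreal_measure)
    also have "\<dots> \<le> ennreal (C * (r k / L) powr \<beta> * M)"
      by (intro ennreal_leI le r_pos r_le)
    finally have "ennreal (c k) * emeasure lebesgue (A \<inter> nbhd E (r k))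
        \<le> ennreal (c k) * ennreal (C * (r k / L) powr \<beta> * M)"
      by (rule mult_left_mono) simp
    also have "\<dots> = ennreal (c k * (C * (r k / L) powr \<beta> * M))"
      using c_nonneg C M by (simp add: ennreal_mult)
    also have "(r k / L) powr \<beta> = (2 powr - \<beta>) ^ k"
      using L powr_power_swap[OF half_nonneg] by (simp add: r_def powr_minus_divide powr_divide)
    also have "c k * (C * (2 powr - \<beta>) ^ k * M) = B * \<rho> ^ k"
      by (simp add: c_def B_def \<rho>_def powr_diff powr_minus field_simps)
    finally show ?thesis .
  qed
  have "(\<integral>\<^sup>+x\<in>A. dist_weight E \<alpha> x \<partial>lebesgue)
      \<le> (\<integral>\<^sup>+x. ennreal (L powr - \<alpha>) * indicator A x
          + (\<Sum>k. ennreal (c k) * indicator (A \<inter> nbhd E (r k)) x) \<partial>lebesgue)"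
    using pointwise by (intro nn_integral_mono) (auto simp: indicator_def split: if_splits)
  also have "\<dots> = ennreal (L powr - \<alpha>) * ennreal M
      + (\<Sum>k. ennreal (c k) * emeasure lebesgue (A \<inter> nbhd E (r k)))"
    by (simp add: nn_integral_add nn_integral_suminf nn_integral_cmult A_M)
  also have "\<dots> \<le> ennreal (L powr - \<alpha>) * ennreal M + (\<Sum>k. ennreal (B * \<rho> ^ k))"
    by (intro add_left_mono suminf_le shell summableI)
  also have "(\<Sum>k. ennreal (B * \<rho> ^ k)) = ennreal (\<Sum>k. B * \<rho> ^ k)"
    using B \<rho> by (intro suminf_ennreal2 summable_mult summable_geometric) auto
  also have "(\<Sum>k. B * \<rho> ^ k) = B / (1 - \<rho>)"
    using \<rho> by (simp add: suminf_mult summable_geometric suminf_geometric)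
  also have "ennreal (L powr - \<alpha>) * ennreal M + ennreal (B / (1 - \<rho>))
      = ennreal (L powr - \<alpha> * M + B / (1 - \<rho>))"
    using M B \<rho> by (simp add: ennreal_mult ennreal_plus)
  also have "L powr - \<alpha> * M + B / (1 - \<rho>)
      = (1 + C * 2 powr \<alpha> / (1 - \<rho>)) * L powr - \<alpha> * M"
    by (simp add: B_def algebra_simps)
  finally show ?thesis
    by (simp add: \<rho>_def)
qed

text \<open>Left of a point \<open>e \<in> E\<close> there is an interval of length \<open>r\<close> inside \<open>E\<^sub>r\<close>, so \<open>r\<close> is at most a multiple of
  \<open>r\<^sup>\<beta>\<close> for all small \<open>r\<close>.\<close>

lemma Mu1_plus_exponent_le_one:
  assumes E: "E \<noteq> {}" and gaps: "\<And>a b. a < b \<Longrightarrow> 0 < gap_L 1 E a b"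
    and \<beta>: "\<beta> \<in> Mu1_plus_exponents E"
  shows "\<beta> \<le> 1"
proof (rule ccontr)
  assume "\<not> \<beta> \<le> 1"
  then have \<beta>1: "0 < \<beta> - 1"
    by simp
  obtain C where C: "0 < C" and expo: "\<And>a b r. a < b \<Longrightarrow> (a + b) / 2 \<in> E \<Longrightarrow>
      0 < r \<Longrightarrow> r \<le> gap_L 1 E ((a + b) / 2) b \<Longrightarrow>
      measure lebesgue (left_half a b \<inter> nbhd E r) / measure lebesgue (left_half a b)
             \<le> C * (r / gap_L 1 E ((a + b) / 2) b) powr \<beta>"
    using \<beta> unfolding Mu1_plus_exponents_def by blast
  obtain e where e: "e \<in> E"
    using E by blast
  define L where "L = gap_L 1 E e (e + 1)"
  have L: "0 < L"
    unfolding L_def by (rule gaps) simp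
  define A where "A = C * L powr - \<beta>"
  have A: "0 < A"
    using C L by (simp add: A_def)
  \<comment> \<open>The last term is chosen so that \<open>A r\<^sup>\<beta> \<le> r/2\<close>.\<close>
  define r where "r = min (min 1 L) ((1 / (2 * A)) powr (1 / (\<beta> - 1)))"
  have r: "0 < r" "r \<le> 1" "r \<le> L"
    using L A by (auto simp: r_def)
  have "r powr (\<beta> - 1) \<le> ((1 / (2 * A)) powr (1 / (\<beta> - 1))) powr (\<beta> - 1)"
    using \<beta>1 r by (intro powr_mono2) (auto simp: r_def)
  also have "\<dots> = 1 / (2 * A)"
    unfolding powr_powr using \<beta>1 A by simp
  finally have small: "A * r powr (\<beta> - 1) \<le> 1 / 2"
    using A by (simp add: field_simps)
  have "{e - r<..<e} \<subseteq> {e - 1<..<e} \<inter> nbhd E r"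
    using r e by (auto simp: nbhd_def dist_real_def intro!: le_less_trans[OF infdist_le[OF e]])
  then have "measure lebesgue {e - r<..<e} \<le> measure lebesgue ({e - 1<..<e} \<inter> nbhd E r)"
    by (intro measure_mono_fmeasurable fmeasurable_Int_fmeasurable) auto
  then have "r \<le> measure lebesgue ({e - 1<..<e} \<inter> nbhd E r)"
    using r by simp
  also have "\<dots> \<le> C * (r / L) powr \<beta>"
    using expo[of "e - 1" "e + 1" r] e r by (simp add: left_half_eq L_def)
  also have "\<dots> = A * (r powr (1 + (\<beta> - 1)))"
    using r L by (simp add: A_def powr_divide powr_minus_divide)
  also have "\<dots> = r * (A * r powr (\<beta> - 1))"
    unfolding powr_add using r by simp
  also have "\<dots> \<le> r * (1 / 2)"
    using small r by (intro mult_left_mono) auto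
  finally show False
    using r by simp
qed

text \<open>The gap length is replaced by the distance at an arbitrary point \<open>x\<close> of the right half. This is possible
  because \<open>d(x)\<close> is at most the distance to the centre \<open>e\<close>, so that \<open>(x - d(x), x)\<close> is a gap inside the right
  half.\<close>

lemma nbhd_decay_left_of_point:
  assumes \<beta>: "\<beta> \<in> Mu1_plus_exponents E"
  obtains C where "0 < C" "\<And>e h x r. e \<in> E \<Longrightarrow> e < x \<Longrightarrow> x < e + h \<Longrightarrow> 0 < r \<Longrightarrow> r \<le> infdist x E \<Longrightarrow>
      measure lebesgue ({e - h<..<e} \<inter> nbhd E r) \<le> C * (r / infdist x E) powr \<beta> * h"
proof -
  obtain C where C: "0 < C" and expo: "\<And>a b r. a < b \<Longrightarrow> (a + b) / 2 \<in> E \<Longrightarrow>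
      0 < r \<Longrightarrow> r \<le> gap_L 1 E ((a + b) / 2) b \<Longrightarrow>
      measure lebesgue (left_half a b \<inter> nbhd E r) / measure lebesgue (left_half a b)
             \<le> C * (r / gap_L 1 E ((a + b) / 2) b) powr \<beta>"
    and \<beta>0: "0 \<le> \<beta>"
    using \<beta> unfolding Mu1_plus_exponents_def by blast
  have "measure lebesgue ({e - h<..<e} \<inter> nbhd E r) \<le> C * (r / infdist x E) powr \<beta> * h"
    if e: "e \<in> E" and x: "e < x" "x < e + h" and r: "0 < r" "r \<le> infdist x E" for e h x r
  proof -
    have h: "0 < h"
      using x by simp
    define L where "L = gap_L 1 E e (e + h)"
    have D: "0 < infdist x E"
      using r by simp
    have De: "infdist x E \<le> x - e"
      using infdist_le[OF e, of x] x by (simp add: dist_real_def)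
    have "{x - infdist x E<..<x} \<subseteq> {e<..<e + h} - E"
      using De x infdist_ball_avoids[of _ x E] by auto
    then have DL: "infdist x E \<le> L"
      using gap_L_ge[of e "e + h" "x - infdist x E" x E] h D by (simp add: L_def)
    have "measure lebesgue ({e - h<..<e} \<inter> nbhd E r) / h \<le> C * (r / L) powr \<beta>"
      using expo[of "e - h" "e + h" r] e h r DL by (simp add: left_half_eq L_def)
    also have "\<dots> \<le> C * (r / infdist x E) powr \<beta>"
      using C D DL r \<beta>0 by (intro mult_left_mono powr_mono2 divide_left_mono) auto
    finally show ?thesis
      using h by (simp add: field_simps)
  qed
  with C that show ?thesis
    by blast
qed

text \<open>The constant collects three contributions: \<open>3\<close> from the
  intervals far from \<open>E\<close>, \<open>2 C\<close> from the part of the left half before the supremum \<open>s\<close> of its points of \<open>E\<close>, and \<open>6\<close> from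
  the gap between \<open>s\<close> and \<open>m\<close>. The last one needs \<open>\<beta> \<le> 1\<close>, since the measure of \<open>E\<^sub>r\<close> in a gap decays only
  linearly in \<open>r\<close>. The point \<open>s\<close> may fail to belong to \<open>E\<close>; it is approximated by points of \<open>E\<close>.\<close>

lemma nbhd_decay_all_intervals:
  assumes E: "E \<noteq> {}" and \<beta>: "\<beta> \<in> Mu1_plus_exponents E" and \<beta>1: "\<beta> \<le> 1"
  obtains C where "0 < C" "\<And>m h x r. m < x \<Longrightarrow> x < m + h \<Longrightarrow> 0 < r \<Longrightarrow> r \<le> infdist x E \<Longrightarrow>
      measure lebesgue ({m - h<..<m} \<inter> nbhd E r) \<le> C * (r / infdist x E) powr \<beta> * h"
proof -
  obtain C where C: "0 < C" and left: "\<And>e h x r. e \<in> E \<Longrightarrow> e < x \<Longrightarrow> x < e + h \<Longrightarrow> 0 < r \<Longrightarrow>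
      r \<le> infdist x E \<Longrightarrow>
      measure lebesgue ({e - h<..<e} \<inter> nbhd E r) \<le> C * (r / infdist x E) powr \<beta> * h"
    by (fact nbhd_decay_left_of_point[OF \<beta>])
  have \<beta>0: "0 \<le> \<beta>"
    using \<beta> by (simp add: Mu1_plus_exponents_def)
  define C' where "C' = 3 + 2 * C + 6"
  have "measure lebesgue ({m - h<..<m} \<inter> nbhd E r) \<le> C' * (r / infdist x E) powr \<beta> * h"
    if x: "m < x" "x < m + h" and r: "0 < r" "r \<le> infdist x E" for m h x r
  proof -
    have h: "0 < h"
      using x by simp
    define D where "D = infdist x E"
    define \<rho> where "\<rho> = (r / D) powr \<beta>"
    have D: "0 < D" "r \<le> D"
      using r by (simp_all add: D_def)
    have \<rho>0: "0 \<le> \<rho>"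
      by (simp add: \<rho>_def)
    have \<rho>: "r \<le> D * \<rho>"
    proof -
      have "(r / D) powr 1 \<le> (r / D) powr \<beta>"
        using D r \<beta>1 by (intro powr_mono') auto
      then show ?thesis
        using D r by (simp add: \<rho>_def field_simps)
    qed
    have Dm: "D \<le> infdist m E + h"
      using infdist_triangle[of x E m] x by (simp add: D_def dist_real_def)
    let ?N = "nbhd E r"
    have "measure lebesgue ({m - h<..<m} \<inter> ?N) \<le> (3 + 2 * C + 6) * \<rho> * h"
    proof (cases "2 * h \<le> infdist m E")
      case True
      have far: "D / 3 \<le> infdist y E" if "m - h < y" "y < m" for y
        using infdist_triangle[of m E y] that True Dm by (simp add: dist_real_def)
      have "measure lebesgue ({m - h<..<m} \<inter> ?N) \<le> 3 * \<rho> * h"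
      proof (cases "r \<le> D / 3")
        case True
        then have "{m - h<..<m} \<inter> ?N = {}"
          using far by (force simp: nbhd_def)
        then show ?thesis
          using h \<rho>0 by simp
      next
        case False
        then have "D * 1 \<le> D * (3 * \<rho>)"
          using \<rho> by simp
        then have "1 \<le> 3 * \<rho>"
          using D by (simp only: mult_le_cancel_left_pos)
        then have "1 * h \<le> 3 * \<rho> * h"
          using h by (intro mult_right_mono) auto
        then show ?thesis
          using measure_Ioo_nbhd_le[of "m - h" m E r] h by linarith
      qed
      also have "\<dots> \<le> (3 + 2 * C + 6) * \<rho> * h"
        using C h \<rho>0 by (intro mult_right_mono) auto
      finally show ?thesis .
    next
      case False
      then have D3h: "D \<le> 3 * h"
        using Dm by simp
      define T where "T = E \<inter> {m - h<..<m}"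
      \<comment> \<open>If the left half contains no point of \<open>E\<close>, the cut is at its left endpoint and the left part is empty.\<close>
      define s where "s = (if T = {} then m - h else Sup T)"
      have bdd: "bdd_above T"
        by (auto simp: T_def intro!: bdd_aboveI[of _ m])
      have upper: "e \<le> s" if "e \<in> T" for e
        using that bdd by (auto simp: s_def intro: cSup_upper)
      have s: "m - h \<le> s" "s \<le> m"
      proof -
        show "s \<le> m"
          using h by (auto simp: s_def T_def intro!: cSup_least)
        show "m - h \<le> s"
        proof (cases "T = {}")
          case False
          then obtain e where "e \<in> T" by blast
          with upper[OF this] show ?thesis
            by (simp add: T_def)
        qed (simp add: s_def)
      qed
      have left_part: "measure lebesgue ({m - h<..<s} \<inter> ?N) \<le> 2 * C * \<rho> * h"
      proof (cases "T = {}")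
        case True
        then show ?thesis
          using C \<rho>0 h by (simp add: s_def)
      next
        case False
        show ?thesis
        proof (rule field_le_epsilon)
          fix \<epsilon> :: real assume "0 < \<epsilon>"
          then obtain e where e: "e \<in> T" "s - \<epsilon> < e"
            using less_cSupD[of T "s - \<epsilon>"] False by (auto simp: s_def)
          then have e': "e \<in> E" "m - h < e" "e < m" "e \<le> s"
            using upper by (auto simp: T_def)
          \<comment> \<open>The interval centred at \<open>e\<close> with right endpoint \<open>m + h\<close> has \<open>x\<close> in its right half, and its left half
            covers everything between \<open>m - h\<close> and \<open>e\<close>.\<close>
          define H where "H = m + h - e"
          have H: "0 < H" "H \<le> 2 * h" "e - H \<le> m - h"
            using e' h by (auto simp: H_def)
          have "measure lebesgue ({m - h<..<s} \<inter> ?N)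
              \<le> measure lebesgue (({e - H<..<e} \<inter> ?N) \<union> {e..s})"
            using H e' by (intro measure_mono_fmeasurable fmeasurable.Un fmeasurable_Int_fmeasurable) auto
          also have "\<dots> \<le> measure lebesgue ({e - H<..<e} \<inter> ?N) + measure lebesgue {e..s}"
            by (intro measure_Un_le) auto
          also have "measure lebesgue ({e - H<..<e} \<inter> ?N) \<le> C * \<rho> * H"
            using left[of e x H r] e' x r by (simp add: H_def \<rho>_def D_def)
          also have "\<dots> \<le> C * \<rho> * (2 * h)"
            using H C \<rho>0 by (intro mult_left_mono) auto
          also have "measure lebesgue {e..s} \<le> \<epsilon>"
            using e e' by simp
          finally show "measure lebesgue ({m - h<..<s} \<inter> ?N) \<le> 2 * C * \<rho> * h + \<epsilon>"
            by (simp add: mult_ac)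
        qed
      qed
      have gap: "min (y - s) (m - y) \<le> infdist y E" if "s < y" "y < m" for y
      proof (rule infdist_in_gap[OF E])
        show "{s<..<m} \<inter> E = {}"
          using upper s by (force simp: T_def)
      qed (use that in auto)
      have "measure lebesgue ({m - h<..<m} \<inter> ?N)
          \<le> measure lebesgue (({m - h<..<s} \<inter> ?N) \<union> ({s..s + r} \<union> {m - r..m}))"
      proof (intro measure_mono_fmeasurable fmeasurable.Un fmeasurable_Int_fmeasurable)
        show "{m - h<..<m} \<inter> ?N \<subseteq> ({m - h<..<s} \<inter> ?N) \<union> ({s..s + r} \<union> {m - r..m})"
        proof
          fix y assume y: "y \<in> {m - h<..<m} \<inter> ?N"
          then have "y < s \<or> y = s \<or> y - s < r \<or> m - y < r"
            using gap[of y] by (auto simp: nbhd_def min_def split: if_splits)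
          then show "y \<in> ({m - h<..<s} \<inter> ?N) \<union> ({s..s + r} \<union> {m - r..m})"
            using y r by auto
        qed
      qed auto
      also have "\<dots> \<le> measure lebesgue ({m - h<..<s} \<inter> ?N) + measure lebesgue ({s..s + r} \<union> {m - r..m})"
        by (intro measure_Un_le) auto
      also have "\<dots> \<le> 2 * C * \<rho> * h + (r + r)"
        using measure_Un_le[of "{s..s + r}" lebesgue "{m - r..m}"] left_part r by simp
      also have "r + r \<le> 6 * \<rho> * h"
        using mult_right_mono[OF D3h \<rho>0] \<rho> by (simp add: mult_ac)
      also have "2 * C * \<rho> * h + 6 * \<rho> * h \<le> (3 + 2 * C + 6) * \<rho> * h"
        using h \<rho>0 by (simp add: algebra_simps)
      finally show ?thesis by simp
    qed
    then show ?thesis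
      by (simp add: C'_def \<rho>_def D_def)
  qed
  moreover have "0 < C'"
    using C by (simp add: C'_def)
  ultimately show ?thesis
    using that by blast
qed

text \<open>The bound on averages serves twice: every compact set lies in the left half of an interval whose
  right half contains a point at positive distance from \<open>E\<close>, which gives local integrability, and then the
  supremum over the right half gives the \<open>A\<^sub>1\<^sup>+\<close> constant.\<close>

lemma A1_plus_if_larger_exponent:
  assumes E: "E \<noteq> {}" and gaps: "\<And>a b. a < b \<Longrightarrow> 0 < gap_L 1 E a b"
    and \<beta>: "\<beta> \<in> Mu1_plus_exponents E" and \<alpha>: "0 < \<alpha>" "\<alpha> < \<beta>"
  shows "A1_plus (dist_weight E \<alpha>)"
proof -
  let ?w = "dist_weight E \<alpha>"
  have \<beta>1: "\<beta> \<le> 1"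
    by (rule Mu1_plus_exponent_le_one[OF E _ \<beta>]) (rule gaps)
  obtain C where C: "0 < C" and decay: "\<And>m h x r. m < x \<Longrightarrow> x < m + h \<Longrightarrow> 0 < r \<Longrightarrow>
      r \<le> infdist x E \<Longrightarrow>
      measure lebesgue ({m - h<..<m} \<inter> nbhd E r) \<le> C * (r / infdist x E) powr \<beta> * h"
    by (fact nbhd_decay_all_intervals[OF E \<beta> \<beta>1])
  define K where "K = 1 + C * 2 powr \<alpha> / (1 - 2 powr (\<alpha> - \<beta>))"
  have "2 powr (\<alpha> - \<beta>) < (1::real)"
    using \<alpha> powr_less_mono[of "\<alpha> - \<beta>" 0 2] by simp
  then have K: "0 \<le> K"
    using C by (simp add: K_def)
  have integral_le: "(\<integral>\<^sup>+y\<in>{m - h<..<m}. ?w y \<partial>lebesgue) \<le> ennreal (K * infdist x E powr - \<alpha> * h)"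
    if "m < x" "x < m + h" "0 < infdist x E" for m h x
    unfolding K_def using that C \<alpha> decay[of m x h]
    by (intro nn_integral_dist_weight_le) auto
  have "(\<integral>\<^sup>+x\<in>S. ?w x \<partial>lebesgue) < \<infinity>" if "compact S" for S
  proof -
    obtain B where B: "0 < B" "\<And>x. x \<in> S \<Longrightarrow> \<bar>x\<bar> < B"
      using compact_imp_bounded[OF \<open>compact S\<close>] unfolding bounded_pos_less by auto
    have "0 < gap_L 1 E B (B + 2 * B)"
      using B by (intro gaps) simp
    then obtain x where x: "B < x" "x < B + 2 * B" "0 < infdist x E"
      using gap_L_pos_iff[OF _ E, of B "B + 2 * B"] B by auto
    have "(\<integral>\<^sup>+x\<in>S. ?w x \<partial>lebesgue) \<le> (\<integral>\<^sup>+x\<in>{B - 2 * B<..<B}. ?w x \<partial>lebesgue)"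
      using B(2) by (intro nn_integral_mono mult_left_mono) (force simp: indicator_def abs_less_iff)+
    also have "\<dots> \<le> ennreal (K * infdist x E powr - \<alpha> * (2 * B))"
      by (rule integral_le[OF x])
    also have "\<dots> < \<infinity>"
      by simp
    finally show ?thesis .
  qed
  then have weight: "weight ?w"
    by (auto simp: weight_def locally_integrable_def dist_weight_pos)
  have quot: "(\<integral>\<^sup>+x\<in>left_half a b. ?w x \<partial>lebesgue) / emeasure lebesgue (left_half a b)
      * esssup (restrict_space lebesgue (right_half a b)) (\<lambda>x. inverse (?w x)) \<le> ennreal K"
    if "a < b" for a b
  proof -
    define m h where "m = (a + b) / 2" and "h = (b - a) / 2"
    have h: "0 < h" and a: "a = m - h" and b: "b = m + h"
      using that by (auto simp: m_def h_def field_simps)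
    define X where "X = (\<integral>\<^sup>+x\<in>{m - h<..<m}. ?w x \<partial>lebesgue)"
    let ?R = "{m<..<m + h}"
    have "esssup (restrict_space lebesgue ?R) (\<lambda>x. inverse (?w x)) \<le> (SUP x\<in>?R. inverse (?w x))"
    proof (rule esssup_I)
      show "(\<lambda>x. inverse (?w x)) \<in> borel_measurable (restrict_space lebesgue ?R)"
        by (intro measurable_restrict_space1) measurable
      show "AE x in restrict_space lebesgue ?R. inverse (?w x) \<le> (SUP x\<in>?R. inverse (?w x))"
        by (intro AE_I2 SUP_upper) (simp add: space_restrict_space)
    qed
    then have "X / ennreal h * esssup (restrict_space lebesgue ?R) (\<lambda>x. inverse (?w x))
        \<le> X / ennreal h * (SUP x\<in>?R. inverse (?w x))"
      by (rule mult_left_mono) simp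
    also have "\<dots> = (SUP x\<in>?R. X / ennreal h * inverse (?w x))"
      by (rule SUP_mult_left_ennreal)
    also have "\<dots> \<le> ennreal K"
    proof (rule SUP_least)
      fix x assume x: "x \<in> ?R"
      show "X / ennreal h * inverse (?w x) \<le> ennreal K"
      proof (cases "infdist x E = 0")
        case True
        then show ?thesis
          using \<alpha> by (simp add: inverse_dist_weight)
      next
        case False
        then have D: "0 < infdist x E"
          using infdist_nonneg[of x E] by simp
        have "X / ennreal h \<le> ennreal (K * infdist x E powr - \<alpha> * h) / ennreal h"
          unfolding X_def using x D by (intro divide_right_mono_ennreal integral_le) auto
        also have "\<dots> = ennreal (K * infdist x E powr - \<alpha>)"
          using h K by (simp add: divide_ennreal)
        finally have "X / ennreal h * ennreal (infdist x E powr \<alpha>)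
            \<le> ennreal (K * infdist x E powr - \<alpha>) * ennreal (infdist x E powr \<alpha>)"
          by (rule mult_right_mono) simp
        also have "\<dots> = ennreal K"
          using D K by (simp add: powr_minus flip: ennreal_mult)
        finally show ?thesis
          by (simp add: inverse_dist_weight[OF \<alpha>(1)])
      qed
    qed
    finally show ?thesis
      using h by (simp add: a b left_half_eq right_half_eq X_def)
  qed
  then have "Sup {(\<integral>\<^sup>+x\<in>left_half a b. ?w x \<partial>lebesgue) / emeasure lebesgue (left_half a b)
      * esssup (restrict_space lebesgue (right_half a b)) (\<lambda>x. inverse (?w x)) | a b. a < b}
      \<le> ennreal K"
    by (intro Sup_least) blast
  also have "\<dots> < \<infinity>"
    by simp
  finally show ?thesis
    unfolding A1_plus_def using weight by blast
qed


section \<open>Characterization of the A1 distance weights\<close>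

theorem theorem1p9:
  fixes E :: "real set" and \<alpha> :: real
  assumes "E \<noteq> {}" and "\<alpha> > 0"
  shows "A1_plus (dist_weight E \<alpha>) \<longleftrightarrow> ereal \<alpha> < Mu1_plus E"
proof
  assume A1: "A1_plus (dist_weight E \<alpha>)"
  then have "\<not> (\<exists>a b. a < b \<and> gap_L 1 E a b = 0)"
    using A1_plus_gap_pos[OF A1 assms(1)] by (metis less_irrefl)
  moreover obtain \<beta> where "\<alpha> < \<beta>" "\<beta> \<in> Mu1_plus_exponents E"
    using A1_plus_larger_exponent[OF A1 assms(2,1)] by blast
  ultimately show "ereal \<alpha> < Mu1_plus E"
    by (auto simp: Mu1_plus_def less_SUP_iff)
next
  assume less: "ereal \<alpha> < Mu1_plus E"
  then have no_zero: "\<not> (\<exists>a b. a < b \<and> gap_L 1 E a b = 0)"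
    using assms(2) by (auto simp: Mu1_plus_def split: if_splits)
  with less obtain \<beta> where "\<alpha> < \<beta>" "\<beta> \<in> Mu1_plus_exponents E"
    by (auto simp: Mu1_plus_def less_SUP_iff)
  moreover have "0 < gap_L 1 E a b" if "a < b" for a b
    using no_zero gap_L_nonneg[OF that, of E] that by (metis order_le_less)
  ultimately show "A1_plus (dist_weight E \<alpha>)"
    using A1_plus_if_larger_exponent[OF assms(1)] assms(2) by blast
qed

end
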